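(* The edge-forcing number of the butterfly network $BF(4)$ is $25$: $\zeta_e(BF(4))=25$.
   Context: The $r$-dimensional butterfly network $BF(r)$ has vertex set $\{[w;i] : w\in\{0,1\}^r,\ 0\le i\le r\}$, and $[w;i]$ is adjacent to $[w';j]$ iff $j=i+1$ and either $w=w'$ or $w$ and $w'$ differ precisely in the $j$-th bit. Forcing (closure) rule: for a graph $G=(V,E)$ and $T\subseteq V$, the closure $C_G(T)$ starts as $T$ and, as long as some vertex of $C_G(T)$ has exactly one neighbor not in $C_G(T)$, that neighbor is added. Edge-forcing set: a set $K$ of pairwise independent edges of $G$ such that, with $T$ the set of endpoints of edges of $K$, $C_G(T)=V$. $\zeta_e(G)$ is the minimum cardinality of an edge-forcing set of $G$. *)

theory Defs
  imports Main
begin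

text \<open>A simple undirected graph is a pair of a vertex set and a set of edges, each edge being
  the two-element set of its endpoints.\<close>

type_synonym 'a graph = "'a set \<times> 'a set set"

definition verts :: "'a graph \<Rightarrow> 'a set" where
  "verts G = fst G"

definition edges :: "'a graph \<Rightarrow> 'a set set" where
  "edges G = snd G"

definition neighbors :: "'a graph \<Rightarrow> 'a \<Rightarrow> 'a set" where
  "neighbors G u = {v. {u, v} \<in> edges G}"

inductive_set forcing_closure :: "'a graph \<Rightarrow> 'a set \<Rightarrow> 'a set" for G :: "'a graph" and T :: "'a set" where
  start: "v \<in> T \<Longrightarrow> v \<in> forcing_closure G T"
| force: "\<lbrakk>u \<in> forcing_closure G T; v \<in> neighbors G u;
           \<forall>x \<in> neighbors G u. x \<noteq> v \<longrightarrow> x \<in> forcing_closure G T\<rbrakk> \<Longrightarrow> v \<in> forcing_closure G T"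

text \<open>The inductive set above is the outcome of the forcing process, regardless of the order in
  which vertices are added: \<open>force_step G C C'\<close> adds the unique neighbor outside \<open>C\<close> of some
  vertex of \<open>C\<close>, and any exhausted run of such steps from \<open>T\<close> ends in \<open>forcing_closure G T\<close>.\<close>

definition force_step :: "'a graph \<Rightarrow> 'a set \<Rightarrow> 'a set \<Rightarrow> bool" where
  "force_step G C C' \<longleftrightarrow> (\<exists>u \<in> C. \<exists>v. neighbors G u - C = {v} \<and> C' = insert v C)"

lemma force_run_eq_closure:
  assumes run: "(force_step G)\<^sup>*\<^sup>* T C" and stop: "\<nexists>C'. force_step G C C'"
  shows "C = forcing_closure G T"
proof
  from run show "C \<subseteq> forcing_closure G T"
  proof (induction rule: rtranclp_induct)
    case base
    show ?case by (auto intro: forcing_closure.start)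
  next
    case (step C C')
    then obtain u v where u: "u \<in> C" "neighbors G u - C = {v}" "C' = insert v C"
      unfolding force_step_def by blast
    have "v \<in> forcing_closure G T"
      by (rule forcing_closure.force[of u]) (use u step.IH in blast)+
    with u step.IH show ?case by blast
  qed
  from run have TC: "T \<subseteq> C"
    by (induction rule: rtranclp_induct) (auto simp: force_step_def)
  show "forcing_closure G T \<subseteq> C"
  proof
    fix v assume "v \<in> forcing_closure G T"
    then show "v \<in> C"
    proof induction
      case (start v)
      with TC show ?case by blast
    next
      case (force u v)
      show ?case
      proof (rule ccontr)
        assume "v \<notin> C"
        with force have "neighbors G u - C = {v}" by blast
        with force stop show False unfolding force_step_def by blast
      qed
    qed
  qed
qed

definition independent_edges :: "'a set set \<Rightarrow> bool" where
  "independent_edges K \<longleftrightarrow> (\<forall>e \<in> K. \<forall>f \<in> K. e \<noteq> f \<longrightarrow> e \<inter> f = {})"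

definition edge_forcing_set :: "'a graph \<Rightarrow> 'a set set \<Rightarrow> bool" where
  "edge_forcing_set G K \<longleftrightarrow>
     K \<subseteq> edges G \<and> independent_edges K \<and> forcing_closure G (\<Union>K) = verts G"

definition edge_forcing_number :: "'a graph \<Rightarrow> nat" where
  "edge_forcing_number G = (LEAST n. \<exists>K. edge_forcing_set G K \<and> finite K \<and> card K = n)"

text \<open>A vertex \<open>[w; i]\<close> is the pair \<open>(w, i)\<close>, with \<open>w\<close> a bit string of length \<open>r\<close>. Bits are numbered
  from 1, so the \<open>j\<close>-th bit of \<open>w\<close> is \<open>w ! (j - 1)\<close>.\<close>

definition differ_precisely_in_bit :: "nat \<Rightarrow> bool list \<Rightarrow> bool list \<Rightarrow> bool" where
  "differ_precisely_in_bit j w w' \<longleftrightarrow>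
     length w = length w' \<and> {k \<in> {1..length w}. w ! (k - 1) \<noteq> w' ! (k - 1)} = {j}"

definition BF_verts :: "nat \<Rightarrow> (bool list \<times> nat) set" where
  "BF_verts r = {(w, i) | w i. length w = r \<and> i \<le> r}"

definition BF :: "nat \<Rightarrow> (bool list \<times> nat) graph" where
  "BF r = (BF_verts r,
     {{(w, i), (w', j)} | w i w' j.
        (w, i) \<in> BF_verts r \<and> (w', j) \<in> BF_verts r \<and> j = i + 1 \<and>
        (w = w' \<or> differ_precisely_in_bit j w w')})"

end

theory Submission
  imports Defs
begin

text \<open>
  Call a set \<open>X\<close> of vertices even if every vertex has an even number of neighbors in \<open>X\<close>.
  Two even sets that agree on \<open>T\<close> agree on the forcing closure of \<open>T\<close>. Hence, if every
  subset of \<open>B\<close> is the trace on \<open>B\<close> of an even set contained in \<open>E\<close>, a forcing set \<open>T\<close>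
  satisfies \<open>card B \<le> card (T \<inter> E)\<close>.

  In \<open>BF 4\<close> take for \<open>E\<close> the vertices on the even levels 0, 2, 4. An even set inside \<open>E\<close> is
  given over GF(2) by functions \<open>a\<close>, \<open>c\<close>, \<open>e\<close> of the bits \<open>p q x y\<close> on these levels such that
  \<open>a\<close> has the same difference in direction \<open>p\<close> as \<open>c\<close> in direction \<open>q\<close>, and \<open>e\<close> the same
  difference in direction \<open>y\<close> as \<open>c\<close> in direction \<open>x\<close>. This is solvable for \<open>a\<close> and \<open>e\<close> iff
  \<open>c\<close> lies in the span of the products of \<open>1, p, q\<close> with \<open>1, x, y\<close>; together with the free
  values of \<open>a\<close> at \<open>p = 0\<close> and of \<open>e\<close> at \<open>y = 0\<close> there are 9 + 8 + 8 = 25 degrees of freedom.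
  Every edge has exactly one endpoint in \<open>E\<close>, so an edge-forcing set has at least 25 edges.
\<close>

section \<open>Even sets bound forcing sets from below\<close>

definition even_set :: "'a graph \<Rightarrow> 'a set \<Rightarrow> bool" where
  "even_set G X \<longleftrightarrow> (\<forall>u. even (card (neighbors G u \<inter> X)))"

text \<open>When \<open>u\<close> forces \<open>v\<close>, the two sets already agree on all other
  neighbors of \<open>u\<close>, so the parity at \<open>u\<close> decides \<open>v\<close> in the
  same way for both.\<close>

lemma even_sets_agree_on_forcing_closure:
  assumes fin: "\<And>u. finite (neighbors G u)"
    and X: "even_set G X" and Y: "even_set G Y" and XY: "X \<inter> T = Y \<inter> T"
    and v: "v \<in> forcing_closure G T"
  shows "v \<in> X \<longleftrightarrow> v \<in> Y"
  using v
proof induction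
  case (start v)
  with XY show ?case by blast
next
  case (force u v)
  define R where "R = neighbors G u - {v}"
  have R: "finite R" "v \<notin> R" "neighbors G u = insert v R"
    using fin[of u] force by (auto simp: R_def)
  have same: "R \<inter> X = R \<inter> Y"
    using force by (auto simp: R_def)
  have parity: "even (card (insert v R \<inter> X))" "even (card (insert v R \<inter> Y))"
    using X Y R(3) by (metis even_set_def)+
  show ?case
    using parity R(1,2) same by (auto simp: Int_insert_left split: if_splits)
qed

lemma card_le_card_forcing_set:
  assumes fin: "\<And>u. finite (neighbors G u)" "finite B" "finite T"
    and B: "B \<subseteq> forcing_closure G T"
    and ext: "\<And>S. S \<subseteq> B \<Longrightarrow> \<exists>X\<subseteq>E. even_set G X \<and> X \<inter> B = S"
  shows "card B \<le> card (T \<inter> E)"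
proof -
  obtain X where X: "\<And>S. S \<subseteq> B \<Longrightarrow> X S \<subseteq> E \<and> even_set G (X S) \<and> X S \<inter> B = S"
    using ext by metis
  \<comment> \<open>The trace of \<open>X S\<close> on \<open>T\<close> determines its trace on the
    closure, hence on \<open>B\<close>, where it is \<open>S\<close>.\<close>
  have "inj_on (\<lambda>S. X S \<inter> T) (Pow B)"
  proof (rule inj_onI)
    fix S S' assume S: "S \<in> Pow B" "S' \<in> Pow B" "X S \<inter> T = X S' \<inter> T"
    then have "X S \<inter> B = X S' \<inter> B"
      using even_sets_agree_on_forcing_closure[OF fin(1), of "X S" "X S'" T] X B by blast
    with S X show "S = S'" by auto
  qed
  moreover have "(\<lambda>S. X S \<inter> T) ` Pow B \<subseteq> Pow (T \<inter> E)"
    using X by blast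
  ultimately have "card (Pow B) \<le> card (Pow (T \<inter> E))"
    by (rule card_inj_on_le) (simp add: fin)
  then show ?thesis
    by (simp add: card_Pow fin del: Pow_Int_eq)
qed

section \<open>The butterfly network\<close>

definition flip :: "nat \<Rightarrow> bool list \<Rightarrow> bool list" where
  "flip k w = w[k := \<not> w ! k]"

lemma length_flip [simp]: "length (flip k w) = length w"
  by (simp add: flip_def)

lemma flip_flip [simp]: "k < length w \<Longrightarrow> flip k (flip k w) = w"
  by (simp add: flip_def)

text \<open>The 1-based bit \<open>Suc k\<close> is list index \<open>k\<close>, so an edge from
  level \<open>i\<close> to level \<open>Suc i\<close> may flip index \<open>i\<close>.\<close>

lemma differ_precisely_in_bit_iff_flip:
  "differ_precisely_in_bit (Suc k) w w' \<longleftrightarrow> k < length w \<and> w' = flip k w"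
proof
  assume d: "differ_precisely_in_bit (Suc k) w w'"
  then have len: "length w = length w'"
    and eq: "{j \<in> {1..length w}. w ! (j - 1) \<noteq> w' ! (j - 1)} = {Suc k}"
    unfolding differ_precisely_in_bit_def by blast+
  have diff: "j \<in> {1..length w} \<and> w ! (j - 1) \<noteq> w' ! (j - 1) \<longleftrightarrow> j = Suc k" for j
    using eq by blast
  have k: "k < length w" "w ! k \<noteq> w' ! k"
    using diff[of "Suc k"] by auto
  have "w' ! j = flip k w ! j" if "j < length w" for j
    using diff[of "Suc j"] that k by (cases "j = k") (auto simp: flip_def)
  then have "w' = flip k w"
    by (intro nth_equalityI) (simp_all add: len)
  with k show "k < length w \<and> w' = flip k w" by simp
next
  assume k: "k < length w \<and> w' = flip k w"
  have "1 \<le> j \<and> j \<le> length w \<and> w ! (j - 1) \<noteq> w' ! (j - 1) \<longleftrightarrow> j = Suc k" for j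
    using k by (cases j) (auto simp: flip_def nth_list_update)
  with k show "differ_precisely_in_bit (Suc k) w w'"
    by (simp add: differ_precisely_in_bit_def set_eq_iff)
qed

text \<open>Executable, so that a forcing run can be evaluated by \<open>code_simp\<close>. It is
  meant for arguments in \<open>BF_verts r\<close>; elsewhere it may list non-neighbors.\<close>

definition BF_nbrs :: "nat \<Rightarrow> bool list \<times> nat \<Rightarrow> (bool list \<times> nat) list" where
  "BF_nbrs r = (\<lambda>(w, i).
     (if i < r then [(w, Suc i), (flip i w, Suc i)] else []) @
     (if 0 < i then [(w, i - 1), (flip (i - 1) w, i - 1)] else []))"

lemma BF_edge_iff:
  "e \<in> edges (BF r) \<longleftrightarrow>
     (\<exists>w i w'. e = {(w, i), (w', Suc i)} \<and> length w = r \<and> i < r \<and> (w' = w \<or> w' = flip i w))"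
  (is "_ \<longleftrightarrow> ?R")
proof
  assume "e \<in> edges (BF r)"
  then obtain w i w' where "e = {(w, i), (w', Suc i)}" "length w = r" "Suc i \<le> r"
    "w = w' \<or> differ_precisely_in_bit (Suc i) w w'"
    by (auto simp: edges_def BF_def BF_verts_def)
  then show ?R
    by (intro exI[of _ w] exI[of _ i] exI[of _ w']) (auto simp: differ_precisely_in_bit_iff_flip)
next
  assume ?R
  then obtain w i w' where "e = {(w, i), (w', Suc i)}" "length w = r" "i < r"
    "w' = w \<or> w' = flip i w"
    by blast
  then show "e \<in> edges (BF r)"
    unfolding edges_def BF_def snd_conv mem_Collect_eq
    by (intro exI[of _ w] exI[of _ i] exI[of _ w'] exI[of _ "Suc i"])
      (auto simp: BF_verts_def differ_precisely_in_bit_iff_flip)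
qed

lemma verts_BF: "verts (BF r) = BF_verts r"
  by (simp add: verts_def BF_def)

lemma edge_BF_subset: "e \<in> edges (BF r) \<Longrightarrow> e \<subseteq> BF_verts r"
  by (auto simp: edges_def BF_def)

lemma neighbors_BF_subset: "neighbors (BF r) u \<subseteq> BF_verts r"
  using edge_BF_subset by (fastforce simp: neighbors_def)

lemma neighbors_BF:
  assumes "u \<in> BF_verts r"
  shows "neighbors (BF r) u = set (BF_nbrs r u)"
proof -
  obtain w i where u: "u = (w, i)" "length w = r" "i \<le> r"
    using assms by (auto simp: BF_verts_def)
  have "v \<in> neighbors (BF r) (w, i) \<longleftrightarrow> v \<in> set (BF_nbrs r (w, i))" for v
  proof
    assume "v \<in> neighbors (BF r) (w, i)"
    then obtain w1 j w2 where e: "{(w, i), v} = {(w1, j), (w2, Suc j)}"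
      and w1: "length w1 = r" "j < r" "w2 = w1 \<or> w2 = flip j w1"
      unfolding neighbors_def mem_Collect_eq BF_edge_iff by blast
    from e consider "w1 = w" "j = i" "v = (w2, Suc j)" | "w2 = w" "Suc j = i" "v = (w1, j)"
      by (auto simp: doubleton_eq_iff)
    then show "v \<in> set (BF_nbrs r (w, i))"
      using w1 by cases (auto simp: BF_nbrs_def)
  next
    assume "v \<in> set (BF_nbrs r (w, i))"
    then consider w' where "i < r" "v = (w', Suc i)" "w' = w \<or> w' = flip i w"
      | k w' where "i = Suc k" "v = (w', k)" "w' = w \<or> w' = flip k w"
      by (auto simp: BF_nbrs_def gr0_conv_Suc split: if_splits)
    then have "{(w, i), v} \<in> edges (BF r)"
    proof cases
      case (1 w')
      with u(2) show ?thesis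
        unfolding BF_edge_iff by blast
    next
      case (2 k w')
      then have "{(w, i), v} = {(w', k), (w, Suc k)}" "length w' = r" "k < r"
        "w = w' \<or> w = flip k w'"
        using u(2,3) by auto
      then show ?thesis
        unfolding BF_edge_iff by blast
    qed
    then show "v \<in> neighbors (BF r) (w, i)"
      by (simp add: neighbors_def)
  qed
  then show ?thesis
    unfolding u(1) by blast
qed

lemma neighbors_BF_outside: "u \<notin> BF_verts r \<Longrightarrow> neighbors (BF r) u = {}"
  unfolding neighbors_def using edge_BF_subset by fast

definition BF_list :: "nat \<Rightarrow> (bool list \<times> nat) list" where
  "BF_list r = List.product (List.n_lists r [False, True]) [0..<Suc r]"

lemma set_BF_list: "set (BF_list r) = BF_verts r"
proof -
  have "w \<in> set (List.n_lists r [False, True]) \<longleftrightarrow> length w = r" for w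
    by (simp add: set_n_lists subset_iff)
  moreover have "i \<in> set [0..<Suc r] \<longleftrightarrow> i \<le> r" for i
    unfolding set_upt by simp linarith
  ultimately show ?thesis
    unfolding BF_list_def BF_verts_def set_product by blast
qed

lemma finite_BF_verts: "finite (BF_verts r)"
  by (metis set_BF_list finite_set)

lemma finite_neighbors_BF: "finite (neighbors (BF r) u)"
  using neighbors_BF_subset finite_BF_verts by (rule finite_subset)

lemma forcing_closure_BF_subset:
  assumes "T \<subseteq> BF_verts r"
  shows "forcing_closure (BF r) T \<subseteq> BF_verts r"
proof
  fix v assume "v \<in> forcing_closure (BF r) T"
  then show "v \<in> BF_verts r"
  proof cases
    case start
    with assms show ?thesis by blast
  next
    case (force u)
    then show ?thesis using neighbors_BF_subset[of r u] by blast
  qed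
qed

lemma Union_edges_BF_subset: "K \<subseteq> edges (BF r) \<Longrightarrow> \<Union>K \<subseteq> BF_verts r"
  by (meson Union_least edge_BF_subset subsetD)

lemma card_even_levels_le:
  assumes K: "K \<subseteq> edges (BF r)" and fin: "finite K"
  shows "card (\<Union>K \<inter> {(w, i). even i}) \<le> card K"
proof -
  define E where "E = {(w :: bool list, i :: nat). even i}"
  have "\<exists>v. e \<inter> E \<subseteq> {v}" if e: "e \<in> K" for e
  proof -
    obtain w i w' where "e = {(w, i), (w', Suc i)}"
      using subsetD[OF K e] unfolding BF_edge_iff by blast
    then show ?thesis by (cases "even i") (auto simp: E_def)
  qed
  then obtain f where "\<And>e. e \<in> K \<Longrightarrow> e \<inter> E \<subseteq> {f e}"
    by metis
  then have "\<Union>K \<inter> E \<subseteq> f ` K"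
    by fast
  then show ?thesis
    unfolding E_def using fin by (meson card_image_le card_mono finite_imageI order_trans)
qed

section \<open>Even sets of the four-dimensional butterfly\<close>

lemma length_4_iff: "length w = 4 \<longleftrightarrow> (\<exists>p q x y. w = [p, q, x, y])"
  by (simp add: eval_nat_numeral length_Suc_conv) blast

text \<open>The pairs other than (1, 1) are interpolation nodes for the span of 1, p, q, and
  likewise for 1, x, y; level 2 thus contributes 3 * 3 nodes.\<close>

definition free_verts :: "(bool list \<times> nat) set" where
  "free_verts = set (filter (\<lambda>(w, i).
      i = 0 \<and> \<not> w ! 0 \<or>
      i = 2 \<and> \<not> (w ! 0 \<and> w ! 1) \<and> \<not> (w ! 2 \<and> w ! 3) \<or>
      i = 4 \<and> \<not> w ! 3) (BF_list 4))"

lemma card_free_verts: "card free_verts = 25"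
  unfolding free_verts_def card_set by code_simp

text \<open>The unique polynomial over GF(2) in the span of \<open>1, p, q\<close> with prescribed values off \<open>(1, 1)\<close>.\<close>

definition affine_ext :: "(bool \<Rightarrow> bool \<Rightarrow> bool) \<Rightarrow> bool \<Rightarrow> bool \<Rightarrow> bool" where
  "affine_ext f p q = (if p \<and> q then f False False \<noteq> (f True False \<noteq> f False True) else f p q)"

lemma affine_ext_eq: "\<not> (p \<and> q) \<Longrightarrow> affine_ext f p q = f p q"
  by (simp only: affine_ext_def if_False)

lemma even_set_extension:
  assumes S: "S \<subseteq> free_verts"
  shows "\<exists>X\<subseteq>{(w, i). even i}. even_set (BF 4) X \<and> X \<inter> free_verts = S"
proof -
  define s where "s i p q x y \<longleftrightarrow> ([p, q, x, y], i) \<in> S" for i :: nat and p q x y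
  \<comment> \<open>Interpolating in \<open>x\<close>, \<open>y\<close> and then in
    \<open>p\<close>, \<open>q\<close> makes \<open>c\<close> affine in each of the two pairs
    separately.\<close>
  define c where "c p q x y = affine_ext (\<lambda>p q. affine_ext (s 2 p q) x y) p q" for p q x y
  \<comment> \<open>Here \<open>\<noteq>\<close> is addition over GF(2): at \<open>p = True\<close>
    the free value at \<open>p = False\<close> is corrected by the increment that parity on level 1
    demands.\<close>
  define a where "a p q x y \<longleftrightarrow>
    (s 0 False q x y \<noteq> (p \<and> (c False q x y \<noteq> c False (\<not> q) x y)))" for p q x y
  define e where "e p q x y \<longleftrightarrow>
    (s 4 p q x False \<noteq> (y \<and> (c p q x False \<noteq> c p q (\<not> x) False)))" for p q x y
  define X where "X = {(w, i :: nat). \<exists>p q x y. w = [p, q, x, y] \<and>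
    (i = 0 \<and> a p q x y \<or> i = 2 \<and> c p q x y \<or> i = 4 \<and> e p q x y)}"
  have mem: "([p, q, x, y], i) \<in> X \<longleftrightarrow>
    i = 0 \<and> a p q x y \<or> i = 2 \<and> c p q x y \<or> i = 4 \<and> e p q x y" for p q x y i
    by (simp add: X_def)
  \<comment> \<open>No monomial of \<open>c\<close> contains both \<open>p\<close> and
    \<open>q\<close>, so its difference in direction \<open>q\<close> does not depend on
    \<open>p\<close>.\<close>
  have a_diff: "(a p q x y \<noteq> a (\<not> p) q x y) \<longleftrightarrow> (c p q x y \<noteq> c p (\<not> q) x y)" for p q x y
    by (cases p; cases q) (auto simp: a_def c_def affine_ext_def)
  have e_diff: "(e p q x y \<noteq> e p q x (\<not> y)) \<longleftrightarrow> (c p q x y \<noteq> c p q (\<not> x) y)" for p q x y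
    by (cases x; cases y) (auto simp: e_def c_def affine_ext_def)
  have "even (card (neighbors (BF 4) u \<inter> X))" for u
  proof (cases "u \<in> BF_verts 4")
    case True
    then obtain p q x y i where u: "u = ([p, q, x, y], i)" and "i \<le> 4"
      by (auto simp: BF_verts_def length_4_iff)
    have nbrs: "neighbors (BF 4) u = set (BF_nbrs 4 ([p, q, x, y], i))"
      using neighbors_BF[OF True] u by simp
    from \<open>i \<le> 4\<close> consider "i = 0 \<or> i = 2 \<or> i = 4" | "i = 1" | "i = 3"
      by linarith
    then show ?thesis
    proof cases
      case 1
      then have "neighbors (BF 4) u \<inter> X = {}"
        unfolding nbrs by (auto simp: BF_nbrs_def X_def)
      then show ?thesis by simp
    next
      case 2
      then have "neighbors (BF 4) u = {([p, q, x, y], 0), ([\<not> p, q, x, y], 0),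
          ([p, q, x, y], 2), ([p, \<not> q, x, y], 2)}"
        unfolding nbrs by (auto simp: BF_nbrs_def flip_def eval_nat_numeral)
      then show ?thesis
        using a_diff[of p q x y]
        by (cases "a p q x y"; cases "a (\<not> p) q x y"; cases "c p q x y"; cases "c p (\<not> q) x y")
          (simp_all add: mem Int_insert_left)
    next
      case 3
      then have "neighbors (BF 4) u = {([p, q, x, y], 4), ([p, q, x, \<not> y], 4),
          ([p, q, x, y], 2), ([p, q, \<not> x, y], 2)}"
        unfolding nbrs by (auto simp: BF_nbrs_def flip_def eval_nat_numeral)
      then show ?thesis
        using e_diff[of p q x y]
        by (cases "e p q x y"; cases "e p q x (\<not> y)"; cases "c p q x y"; cases "c p q (\<not> x) y")
          (simp_all add: mem Int_insert_left)
    qed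
  qed (simp add: neighbors_BF_outside)
  moreover have "X \<inter> free_verts = S"
  proof -
    have "v \<in> X \<longleftrightarrow> v \<in> S" if v: "v \<in> free_verts" for v
    proof -
      have "v \<in> BF_verts 4"
        using v by (simp add: free_verts_def set_BF_list)
      then obtain p q x y i where u: "v = ([p, q, x, y], i)"
        by (auto simp: BF_verts_def length_4_iff)
      consider "i = 0" "\<not> p" | "i = 2" "\<not> (p \<and> q)" "\<not> (x \<and> y)" | "i = 4" "\<not> y"
        using v unfolding u free_verts_def by force
      then show ?thesis
        by cases (simp_all only: u mem, simp_all add: a_def c_def e_def s_def affine_ext_eq)
    qed
    with S show ?thesis by blast
  qed
  moreover have "X \<subseteq> {(w, i). even i}"
    by (auto simp: X_def)
  ultimately show ?thesis
    unfolding even_set_def by blast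
qed

lemma edge_forcing_set_BF4_card_ge:
  assumes K: "edge_forcing_set (BF 4) K" and fin: "finite K"
  shows "25 \<le> card K"
proof -
  have edges: "K \<subseteq> edges (BF 4)" and closure: "forcing_closure (BF 4) (\<Union>K) = BF_verts 4"
    using K by (auto simp: edge_forcing_set_def verts_BF)
  have free: "free_verts \<subseteq> BF_verts 4"
    by (auto simp: free_verts_def set_BF_list)
  have "card free_verts \<le> card (\<Union>K \<inter> {(w, i). even i})"
  proof (rule card_le_card_forcing_set[where G = "BF 4"])
    show "finite (\<Union>K)"
      using Union_edges_BF_subset[OF edges] finite_BF_verts by (rule finite_subset)
    show "finite free_verts"
      using free finite_BF_verts by (rule finite_subset)
  qed (use finite_neighbors_BF free closure even_set_extension in auto)
  also have "\<dots> \<le> card K"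
    using edges fin by (rule card_even_levels_le)
  finally show ?thesis
    by (simp add: card_free_verts)
qed

section \<open>An edge-forcing set with 25 edges\<close>

definition force_by :: "('a \<Rightarrow> 'a list) \<Rightarrow> 'a \<Rightarrow> 'a list \<Rightarrow> 'a list" where
  "force_by nb u C =
     (if u \<in> set C then (case filter (\<lambda>x. x \<notin> set C) (nb u) of [v] \<Rightarrow> v # C | _ \<Rightarrow> C) else C)"

text \<open>A vertex that cannot force leaves the list unchanged, so every list \<open>us\<close> is
  sound and only the final result needs checking.\<close>

lemma set_fold_force_by_subset:
  assumes nb: "\<And>u. u \<in> forcing_closure G T \<Longrightarrow> set (nb u) = neighbors G u"
    and C: "set C \<subseteq> forcing_closure G T"
  shows "set (fold (force_by nb) us C) \<subseteq> forcing_closure G T"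
  using C
proof (induction us arbitrary: C)
  case (Cons u us)
  have "set (force_by nb u C) \<subseteq> forcing_closure G T"
  proof (cases "u \<in> set C \<and> (\<exists>v. filter (\<lambda>x. x \<notin> set C) (nb u) = [v])")
    case True
    then obtain v where u: "u \<in> set C" and v: "filter (\<lambda>x. x \<notin> set C) (nb u) = [v]"
      by blast
    have "set (filter (\<lambda>x. x \<notin> set C) (nb u)) = neighbors G u - set C"
      using nb u Cons.prems by auto
    with v have "neighbors G u - set C = {v}" by simp
    then have "v \<in> neighbors G u" "\<forall>x\<in>neighbors G u. x \<noteq> v \<longrightarrow> x \<in> forcing_closure G T"
      using Cons.prems by blast+
    with u Cons.prems have "v \<in> forcing_closure G T"
      by (meson forcing_closure.force subsetD)
    with u v Cons.prems show ?thesis by (simp add: force_by_def)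
  next
    case False
    then have "force_by nb u C = C"
      by (auto simp: force_by_def split: list.splits)
    with Cons.prems show ?thesis by simp
  qed
  with Cons.IH show ?case by simp
qed simp

lemma card_independent_edges_of_list:
  assumes "distinct (map fst es @ map snd es)"
  shows "card ((\<lambda>(u, v). {u, v}) ` set es) = length es"
    and "independent_edges ((\<lambda>(u, v). {u, v}) ` set es)"
proof -
  have fst: "inj_on fst (set es)" and snd: "inj_on snd (set es)"
    and disj: "fst ` set es \<inter> snd ` set es = {}" and "distinct es"
    using assms by (auto simp: distinct_map)
  \<comment> \<open>First and second endpoints never coincide, so two pairs can only meet in equal
    first or equal second components. This yields both claims.\<close>
  have meet: "e = f" if "e \<in> set es" "f \<in> set es" "{fst e, snd e} \<inter> {fst f, snd f} \<noteq> {}" for e f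
  proof -
    have "fst e \<noteq> snd f" "fst f \<noteq> snd e"
      using that(1,2) disj by blast+
    with that(3) have "fst e = fst f \<or> snd e = snd f" by auto
    with that(1,2) fst snd show ?thesis by (meson inj_onD)
  qed
  have "inj_on (\<lambda>e. {fst e, snd e}) (set es)"
  proof (rule inj_onI)
    fix e f assume "e \<in> set es" "f \<in> set es" "{fst e, snd e} = {fst f, snd f}"
    then show "e = f" by (intro meet) simp_all
  qed
  then show "card ((\<lambda>(u, v). {u, v}) ` set es) = length es"
    using \<open>distinct es\<close> by (simp add: card_image distinct_card case_prod_beta')
  show "independent_edges ((\<lambda>(u, v). {u, v}) ` set es)"
    unfolding independent_edges_def case_prod_beta' using meet by blast
qed

definition word4 :: "nat \<Rightarrow> bool list" where
  "word4 n = [odd (n div 8), odd (n div 4), odd (n div 2), odd n]"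

text \<open>The entry \<open>(m, i, n)\<close> stands for the edge from \<open>[m; i]\<close> to \<open>[n; i + 1]\<close>. There is one edge for
  each of the 8 four-cycles between levels 0 and 1 and between levels 3 and 4; the other 9 edges
  cover the vertices of \<^const>\<open>free_verts\<close> on level 2.\<close>

definition BF4_edges :: "((bool list \<times> nat) \<times> (bool list \<times> nat)) list" where
  "BF4_edges = map (\<lambda>(m, i, n). ((word4 m, i), (word4 n, Suc i)))
    [(0, 0, 0), (1, 0, 9), (2, 0, 10), (3, 0, 3), (4, 0, 12), (5, 0, 5), (6, 0, 14), (7, 0, 7),
     (2, 1, 2), (1, 1, 1), (8, 1, 8), (13, 1, 9), (4, 1, 4), (6, 1, 6),
     (0, 2, 0), (10, 2, 10), (5, 2, 5),
     (1, 3, 0), (2, 3, 2), (4, 3, 4), (6, 3, 6), (8, 3, 8), (11, 3, 10), (12, 3, 12), (14, 3, 14)]"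

text \<open>The vertices that perform the 30 forces, in order.\<close>

definition BF4_forcers :: "(bool list \<times> nat) list" where
  "BF4_forcers = map (\<lambda>(n, i). (word4 n, i))
    [(3, 0), (7, 0),
     (0, 1), (1, 1), (2, 1), (4, 1), (5, 1), (6, 1), (8, 1), (9, 1), (10, 1),
     (1, 2), (5, 2), (9, 2),
     (0, 3), (1, 3), (2, 3), (4, 3), (5, 3), (6, 3), (8, 3), (10, 3), (11, 3), (12, 3), (14, 3),
     (12, 4), (14, 4),
     (3, 1), (7, 1), (11, 1)]"

lemma length_BF4_edges: "length BF4_edges = 25"
  by (simp add: BF4_edges_def)

lemma BF4_edges_distinct: "distinct (map fst BF4_edges @ map snd BF4_edges)"
  by code_simp

lemma BF4_edges_adjacent: "\<forall>(u, v)\<in>set BF4_edges. u \<in> set (BF_list 4) \<and> v \<in> set (BF_nbrs 4 u)"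
  by code_simp

text \<open>The 50 endpoints and 30 forced vertices make up all 80 vertices.\<close>

lemma BF4_forcers_exhaust:
  "\<forall>v\<in>set (BF_list 4).
     v \<in> set (fold (force_by (BF_nbrs 4)) BF4_forcers (map fst BF4_edges @ map snd BF4_edges))"
  by code_simp

lemma edge_forcing_set_BF4_edges:
  "edge_forcing_set (BF 4) ((\<lambda>(u, v). {u, v}) ` set BF4_edges)" (is "edge_forcing_set _ ?K")
proof -
  have edges: "?K \<subseteq> edges (BF 4)"
  proof
    fix e assume "e \<in> ?K"
    then obtain u v where uv: "(u, v) \<in> set BF4_edges" and e: "e = {u, v}"
      by (elim imageE) (simp only: split_paired_all prod.case)
    have "u \<in> BF_verts 4" "v \<in> set (BF_nbrs 4 u)"
      using bspec[OF BF4_edges_adjacent uv] by (simp_all only: set_BF_list prod.case)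
    then have "v \<in> neighbors (BF 4) u"
      by (simp add: neighbors_BF)
    with e show "e \<in> edges (BF 4)"
      by (simp add: neighbors_def)
  qed
  have sub: "forcing_closure (BF 4) (\<Union>?K) \<subseteq> BF_verts 4"
    by (rule forcing_closure_BF_subset[OF Union_edges_BF_subset[OF edges]])
  define C where "C = map fst BF4_edges @ map snd BF4_edges"
  have "fst e \<in> \<Union>?K" "snd e \<in> \<Union>?K" if "e \<in> set BF4_edges" for e
    using that by (auto simp only: case_prod_beta' intro!: UN_I[of e])
  then have "set C \<subseteq> \<Union>?K"
    unfolding C_def set_append set_map by blast
  then have C: "set C \<subseteq> forcing_closure (BF 4) (\<Union>?K)"
    by (meson forcing_closure.start subset_iff)
  have "set (BF_nbrs 4 u) = neighbors (BF 4) u" if "u \<in> forcing_closure (BF 4) (\<Union>?K)" for u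
    using neighbors_BF[OF subsetD[OF sub that]] by simp
  then have "set (fold (force_by (BF_nbrs 4)) BF4_forcers C) \<subseteq> forcing_closure (BF 4) (\<Union>?K)"
    using C by (rule set_fold_force_by_subset)
  then have "BF_verts 4 \<subseteq> forcing_closure (BF 4) (\<Union>?K)"
    using BF4_forcers_exhaust unfolding set_BF_list C_def by blast
  with sub have "forcing_closure (BF 4) (\<Union>?K) = BF_verts 4"
    by (rule equalityI)
  then show ?thesis
    unfolding edge_forcing_set_def verts_BF
    by (intro conjI edges card_independent_edges_of_list(2)[OF BF4_edges_distinct])
qed

theorem theorem4p5:
  shows "edge_forcing_number (BF 4) = 25"
  unfolding edge_forcing_number_def
proof (rule Least_equality)
  have "card ((\<lambda>(u, v). {u, v}) ` set BF4_edges) = 25"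
    by (simp only: card_independent_edges_of_list(1)[OF BF4_edges_distinct] length_BF4_edges)
  then show "\<exists>K. edge_forcing_set (BF 4) K \<and> finite K \<and> card K = 25"
    using edge_forcing_set_BF4_edges finite_imageI[OF finite_set] by blast
qed (use edge_forcing_set_BF4_card_ge in blast)

end
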